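(* Let $t\in\mathbb{Q}-\mathbb{Z}$ and let $r\in\mathbb{Z}-\{0\}$ be such that $rt\notin\mathbb{Z}$. Put $h_{r,(0,t)}(\tau):=r\,\zeta(\tau,t)-\zeta(\tau,rt)$ for $\tau\in\mathbb{H}$. Then $$\lim_{\tau\to i\infty}h_{r,(0,t)}(\tau)=2\pi i\left(\frac{r-1}{2}+\frac{r}{\mathbf{e}(t)-1}-\frac{1}{\mathbf{e}(rt)-1}\right).$$
   Context: $\mathbb{H}=\{\tau\in\mathbb{C}\mid \operatorname{Im}\tau>0\}$ and $\mathbf{e}(x):=\exp(2\pi i x)$. For a lattice $\Omega\subset\mathbb{C}$ (a $\mathbb{Z}$-module generated by two $\mathbb{R}$-linearly independent elements), the Weierstrass $\zeta$-function is $$\zeta(\Omega,z)=\frac{1}{z}+\sum_{\omega\in\Omega-\{0\}}\left(\frac{1}{z-\omega}+\frac{1}{\omega}+\frac{z}{\omega^2}\right),$$ and $\zeta(\tau,z):=\zeta(\tau\mathbb{Z}+\mathbb{Z},z)$ for $\tau\in\mathbb{H}$. The limit $\tau\to i\infty$ means $\operatorname{Im}\tau\to\infty$. *)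

theory Defs
  imports "HOL-Analysis.Analysis"
begin

definition upper_half_plane :: "complex set" where
  "upper_half_plane = {\<tau>. Im \<tau> > 0}"

definition e_exp :: "complex \<Rightarrow> complex" where
  "e_exp x = exp (2 * of_real pi * \<i> * x)"

definition lattice_gen :: "complex \<Rightarrow> complex \<Rightarrow> complex set" where
  "lattice_gen \<omega>1 \<omega>2 = {of_int m * \<omega>1 + of_int n * \<omega>2 | m n. True}"

definition is_complex_lattice :: "complex set \<Rightarrow> bool" where
  "is_complex_lattice \<Omega> \<longleftrightarrow>
     (\<exists>\<omega>1 \<omega>2. \<omega>1 \<noteq> \<omega>2 \<and> independent {\<omega>1, \<omega>2} \<and> \<Omega> = lattice_gen \<omega>1 \<omega>2)"

text \<open>
  The sum is taken unconditionally. For a lattice and a point outside it, the summands are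
  of order \<open>norm \<omega> powr (-3)\<close>, so the series converges absolutely. At lattice points
  the value is a junk value.
\<close>
definition weierstrass_zeta :: "complex set \<Rightarrow> complex \<Rightarrow> complex" where
  "weierstrass_zeta \<Omega> z =
     1 / z + (\<Sum>\<^sub>\<infinity>\<omega>\<in>\<Omega> - {0}. 1 / (z - \<omega>) + 1 / \<omega> + z / \<omega>^2)"

definition zeta_tau :: "complex \<Rightarrow> complex \<Rightarrow> complex" where
  "zeta_tau \<tau> z = weierstrass_zeta (lattice_gen \<tau> 1) z"

text \<open>This is $h_{r,(0,t)}(\tau)$; only the case where the first coordinate is zero is covered.\<close>
definition h_zero :: "int \<Rightarrow> rat \<Rightarrow> complex \<Rightarrow> complex" where
  "h_zero r t \<tau> = of_int r * zeta_tau \<tau> (of_rat t) - zeta_tau \<tau> (of_int r * of_rat t)"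

text \<open>
  Only the imaginary part tends to infinity; the real part is unconstrained, so convergence
  along this filter is uniform in the real part.
\<close>
definition at_i_infinity :: "complex filter" where
  "at_i_infinity = inf (filtercomap Im at_top) (principal upper_half_plane)"

lemma eventually_at_i_infinity:
  "eventually P at_i_infinity \<longleftrightarrow> (\<exists>B. \<forall>\<tau>\<in>upper_half_plane. Im \<tau> \<ge> B \<longrightarrow> P \<tau>)"
  unfolding at_i_infinity_def eventually_inf_principal eventually_filtercomap
    eventually_at_top_linorder
  by blast

lemma is_complex_lattice_tau:
  assumes "\<tau> \<in> upper_half_plane"
  shows "is_complex_lattice (lattice_gen \<tau> 1)"
proof -
  have Im: "Im \<tau> > 0"
    using assms by (simp add: upper_half_plane_def)
  hence ne: "\<tau> \<noteq> 1" by auto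
  have "\<tau> \<notin> span {1}"
    using Im by (auto simp: span_singleton)
  moreover have "independent {1 :: complex}"
    by simp
  ultimately have "independent {\<tau>, 1}"
    by (simp add: independent_insert)
  with ne show ?thesis
    unfolding is_complex_lattice_def by blast
qed

end

theory Submission
  imports Defs
begin

text \<open>
  The theorem follows from a limit for the zeta function itself (\<open>zeta_tau_tendsto\<close>): if
  \<open>z\<close> is not an integer, then \<open>\<zeta>(\<tau>, z)\<close> tends to \<open>\<pi> cot (\<pi> z) + \<pi>\<^sup>2 z / 3\<close> as
  \<open>Im \<tau> \<rightarrow> \<infinity>\<close>. The term linear in \<open>z\<close> cancels in \<open>r \<zeta>(\<tau>, t) - \<zeta>(\<tau>, r t)\<close>, and
  \<open>\<pi> cot (\<pi> z) = 2 \<pi> i (1/2 + 1/(e(z) - 1))\<close> turns what remains into the claimed value.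

  For the limit, the lattice points \<open>m \<tau> + n\<close> are split into the row \<open>m = 0\<close>, which does not
  depend on \<open>\<tau>\<close>, and the rows \<open>m \<noteq> 0\<close>. The row \<open>m = 0\<close> is summed exactly
  (\<open>has_sum_zeta_summand_int\<close>): its two halves are the series of the digamma function at
  \<open>1 - z\<close> and \<open>1 + z\<close> together with a multiple of \<open>\<Sum> 1/n\<^sup>2 = \<pi>\<^sup>2/6\<close>, and the reflection
  formula produces the cotangent. For the other rows, a summand equals
  \<open>z\<^sup>2 / (\<omega>\<^sup>2 (z - \<omega>))\<close>, which is cubically small in \<open>\<omega>\<close>. After each row is
  shifted by an integer so that it no longer sees the real part of \<open>\<tau>\<close>, the summands are at most
  \<open>(Im \<tau>)\<^sup>-\<^sup>3\<^sup>/\<^sup>2\<close> times a fixed summable family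
  (\<open>norm_zeta_summand_le\<close>). This gives absolute convergence and the vanishing of these
  rows in the limit, uniformly in \<open>Re \<tau>\<close>.
\<close>

section \<open>The row of real lattice points\<close>

text \<open>The logarithmic derivative of Euler's reflection formula for the gamma function.\<close>
lemma Digamma_reflection_complex:
  fixes z :: complex
  assumes "z \<notin> \<int>"
  shows "Digamma (1 - z) - Digamma z = of_real pi * cot (of_real pi * z)"
proof -
  have z: "z \<notin> \<int>\<^sub>\<le>\<^sub>0" "1 - z \<notin> \<int>\<^sub>\<le>\<^sub>0"
    using assms by auto
  have nz: "Gamma z \<noteq> 0" "Gamma (1 - z) \<noteq> 0"
    using z by (auto simp: Gamma_eq_zero_iff)
  have refl: "Gamma z * Gamma (1 - z) = of_real pi / sin (of_real pi * z)" for z :: complex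
    by (rule Gamma_reflection_complex)
  have sin: "sin (of_real pi * z) \<noteq> 0"
    using refl[of z] nz by auto
  have "((\<lambda>z. Gamma z * Gamma (1 - z)) has_field_derivative
          Gamma z * Gamma (1 - z) * (Digamma z - Digamma (1 - z))) (at z)"
    using z by (auto intro!: derivative_eq_intros simp: algebra_simps)
  moreover have "((\<lambda>z. of_real pi / sin (of_real pi * z)) has_field_derivative
          - (of_real pi / sin (of_real pi * z)) * (of_real pi * cot (of_real pi * z))) (at z)"
    using sin by (auto intro!: derivative_eq_intros simp: cot_def field_simps power2_eq_square)
  ultimately have "Gamma z * Gamma (1 - z) * (Digamma z - Digamma (1 - z)) =
          - (of_real pi / sin (of_real pi * z)) * (of_real pi * cot (of_real pi * z))"
    unfolding refl by (rule DERIV_unique)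
  hence "Digamma z - Digamma (1 - z) = - (of_real pi * cot (of_real pi * z))"
    unfolding refl minus_mult_commute using sin by (subst (asm) mult_left_cancel) auto
  thus ?thesis by (simp add: algebra_simps)
qed

text \<open>
  The correction terms remove the first two orders of \<open>1 / (z - \<omega>)\<close> at infinity; the closed
  form makes the cubic decay visible.
\<close>
lemma zeta_summand_eq:
  fixes z \<omega> :: complex
  assumes "\<omega> \<noteq> 0" "z \<noteq> \<omega>"
  shows "1 / (z - \<omega>) + 1 / \<omega> + z / \<omega>^2 = z^2 / (\<omega>^2 * (z - \<omega>))"
  using assms by (simp add: divide_simps power2_eq_square) (simp add: algebra_simps)

text \<open>
  The series \<open>\<psi>(w) + \<gamma> = \<Sum> (1/(k+1) - 1/(w+k))\<close> at \<open>w = 1 - z\<close> accounts for the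
  first two terms of each summand, and the Basel sum for the third. Separately the two fractions would
  give divergent series; taken together they are absolutely summable, so the ordered sum is also the
  unordered one.
\<close>
lemma has_sum_zeta_summand_nat:
  fixes z :: complex
  assumes "z \<notin> \<int>"
  shows "((\<lambda>k. 1 / (z - of_nat (Suc k)) + 1 / of_nat (Suc k) + z / of_nat (Suc k) ^ 2) has_sum
           (Digamma (1 - z) + euler_mascheroni + z * (of_real pi)\<^sup>2 / 6)) (UNIV :: nat set)"
    (is "(?f has_sum ?S) _")
proof (rule norm_summable_imp_has_sum)
  have "1 - z \<noteq> 0"
    using assms by auto
  have "(\<lambda>k. inverse (of_nat (Suc k)) - inverse ((1 - z) + of_nat k)) sums
          (Digamma (1 - z) + euler_mascheroni)"
    using summable_sums[OF summable_Digamma[OF \<open>1 - z \<noteq> 0\<close>]]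
    by (simp add: Digamma_def del: of_nat_Suc)
  moreover have "(\<lambda>k. z * complex_of_real (1 / (real k + 1)\<^sup>2)) sums (z * of_real (pi\<^sup>2 / 6))"
    using inverse_squares_sums by (intro sums_mult sums_of_real) (auto simp: add_ac)
  ultimately have "(\<lambda>k. inverse (of_nat (Suc k)) - inverse ((1 - z) + of_nat k)
                     + z * complex_of_real (1 / (real k + 1)\<^sup>2)) sums
                   (Digamma (1 - z) + euler_mascheroni + z * of_real (pi\<^sup>2 / 6))"
    by (rule sums_add)
  also have "(\<lambda>k. inverse (of_nat (Suc k)) - inverse ((1 - z) + of_nat k)
                     + z * complex_of_real (1 / (real k + 1)\<^sup>2)) = ?f"
  proof
    fix k :: nat
    have "(1 - z) + of_nat k = - (z - of_nat (Suc k))"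
      by simp
    hence "inverse ((1 - z) + of_nat k) = - (1 / (z - of_nat (Suc k)))"
      by (simp only: inverse_eq_divide minus_divide_right)
    thus "inverse (of_nat (Suc k)) - inverse ((1 - z) + of_nat k)
            + z * complex_of_real (1 / (real k + 1)\<^sup>2) = ?f k"
      by (simp add: inverse_eq_divide add_ac)
  qed
  finally show "?f sums ?S"
    by simp
next
  have "summable (\<lambda>k. norm z ^ 2 * (1 / (real k + 1)\<^sup>2))"
    using inverse_squares_sums by (intro summable_mult) (auto simp: sums_iff add_ac)
  moreover have "norm (norm (?f k)) \<le> norm z ^ 2 * (1 / (real k + 1)\<^sup>2)"
    if k: "k \<ge> nat \<lceil>norm z\<rceil>" for k
  proof -
    have "norm z \<le> real k"
      using k by linarith
    hence "1 \<le> norm (of_nat (Suc k) :: complex) - norm z"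
      by (simp only: norm_of_nat)
    also have "\<dots> \<le> norm (z - of_nat (Suc k))"
      by (metis norm_minus_commute norm_triangle_ineq2)
    finally have ge: "norm (z - of_nat (Suc k)) \<ge> 1" .
    hence ne: "z \<noteq> of_nat (Suc k)"
      by auto
    have norm_Suc: "norm (of_nat (Suc k) :: complex) = real k + 1"
      unfolding norm_of_nat by simp
    have "?f k = z^2 / (of_nat (Suc k)^2 * (z - of_nat (Suc k)))"
      by (rule zeta_summand_eq[OF of_nat_neq_0 ne])
    hence "norm (?f k) = norm z ^ 2 / ((real k + 1)\<^sup>2 * norm (z - of_nat (Suc k)))"
      by (simp only: norm_divide norm_mult norm_power norm_Suc)
    also have "\<dots> \<le> norm z ^ 2 / ((real k + 1)\<^sup>2 * 1)"
      using ge by (intro divide_left_mono mult_left_mono mult_pos_pos) auto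
    finally show ?thesis by simp
  qed
  ultimately show "summable (\<lambda>k. norm (?f k))"
    by (rule summable_comparison_test')
qed

text \<open>
  The summand is odd under \<open>(z, k) \<mapsto> (-z, -k)\<close>, so the negative half of the row is the negated
  positive half at \<open>- z\<close>. The Euler constants cancel, and \<open>\<psi>(1 - z) - \<psi>(1 + z)\<close>
  is evaluated by reflection after one step of the recurrence for \<open>\<psi>\<close>, which contributes
  \<open>- 1 / z\<close>.
\<close>
lemma has_sum_zeta_summand_int:
  fixes z :: complex
  assumes "z \<notin> \<int>"
  shows "((\<lambda>k. 1 / (z - of_int k) + 1 / of_int k + z / of_int k ^ 2) has_sum
           (of_real pi * cot (of_real pi * z) - 1 / z + (of_real pi)\<^sup>2 / 3 * z)) (UNIV - {0 :: int})"
    (is "(?f has_sum _) _")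
proof -
  have "z \<noteq> 0" "- z \<notin> \<int>"
    using assms by auto
  have "((\<lambda>k. 1 / (z - of_nat (Suc k)) + 1 / of_nat (Suc k) + z / of_nat (Suc k) ^ 2) has_sum
           (Digamma (1 - z) + euler_mascheroni + z * (of_real pi)\<^sup>2 / 6)) (UNIV :: nat set)"
    by (rule has_sum_zeta_summand_nat[OF assms])
  also have "?this \<longleftrightarrow> (?f has_sum (Digamma (1 - z) + euler_mascheroni + z * (of_real pi)\<^sup>2 / 6)) {0<..}"
    by (intro has_sum_reindex_bij_witness[of _ "\<lambda>n. nat n - 1" "\<lambda>k. int k + 1"])
       (auto simp: add_ac)
  finally have pos: "(?f has_sum (Digamma (1 - z) + euler_mascheroni + z * (of_real pi)\<^sup>2 / 6)) {0<..}" .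
  have "((\<lambda>k. - (1 / (- z - of_nat (Suc k)) + 1 / of_nat (Suc k) + (- z) / of_nat (Suc k) ^ 2)) has_sum
           - (Digamma (1 - (- z)) + euler_mascheroni + (- z) * (of_real pi)\<^sup>2 / 6)) (UNIV :: nat set)"
    by (intro has_sum_uminusI has_sum_zeta_summand_nat) fact
  also have "?this \<longleftrightarrow> (?f has_sum (- Digamma (1 + z) - euler_mascheroni + z * (of_real pi)\<^sup>2 / 6)) {..<0}"
  proof (intro has_sum_reindex_bij_witness[of _ "\<lambda>n. nat (- n) - 1" "\<lambda>k. - (int k + 1)"])
    fix k :: nat
    have "of_int (- (int k + 1)) = - (of_nat (Suc k) :: complex)"
      and "z - (- of_nat (Suc k)) = - (- z - of_nat (Suc k))"
      by simp_all
    moreover have "1 / (- a) + 1 / (- b) + z / (- b)\<^sup>2 = - (1 / a + 1 / b + (- z) / b\<^sup>2)"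
      for a b :: complex
      by simp
    ultimately show "?f (- (int k + 1)) =
            - (1 / (- z - of_nat (Suc k)) + 1 / of_nat (Suc k) + (- z) / of_nat (Suc k) ^ 2)"
      by (simp only:)
  qed auto
  finally have neg: "(?f has_sum (- Digamma (1 + z) - euler_mascheroni + z * (of_real pi)\<^sup>2 / 6)) {..<0}" .
  have "{0<..} \<union> {..<0} = UNIV - {0 :: int}"
    by auto
  moreover have "(?f has_sum ((Digamma (1 - z) + euler_mascheroni + z * (of_real pi)\<^sup>2 / 6) +
                   (- Digamma (1 + z) - euler_mascheroni + z * (of_real pi)\<^sup>2 / 6))) ({0<..} \<union> {..<0})"
    by (intro has_sum_Un_disjoint pos neg) auto
  moreover have "Digamma (1 + z) = Digamma z + 1 / z"
    using Digamma_plus1[OF \<open>z \<noteq> 0\<close>] by (simp add: add_ac)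
  ultimately show ?thesis
    using Digamma_reflection_complex[OF assms] by (simp add: algebra_simps)
qed

section \<open>The remaining rows\<close>

lemma summable_on_int_powr:
  assumes "s < -1"
  shows "(\<lambda>n. (1 + \<bar>real_of_int n\<bar>) powr s) summable_on UNIV"
proof -
  have "summable (\<lambda>n. real (Suc n) powr s)"
    using assms by (subst summable_Suc_iff) (simp add: summable_real_powr_iff)
  hence nat: "(\<lambda>n. real (Suc n) powr s) summable_on UNIV"
    by (rule summable_nonneg_imp_summable_on) auto
  have "(\<lambda>n. (1 + \<bar>real_of_int n\<bar>) powr s) summable_on {0..}"
    using nat by (subst summable_on_reindex_bij_witness[of _ int nat _ "\<lambda>n. real (Suc n) powr s"]) auto
  moreover have "(\<lambda>n. (1 + \<bar>real_of_int n\<bar>) powr s) summable_on {..<0}"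
  proof (subst summable_on_reindex_bij_witness[of _ "\<lambda>n. - int n" "\<lambda>n. nat (-n)" _ "\<lambda>n. real (Suc n) powr s"])
    show "(\<lambda>n. real (Suc n) powr s) summable_on {0<..}"
      using nat by (rule summable_on_subset) auto
  qed auto
  ultimately have "(\<lambda>n. (1 + \<bar>real_of_int n\<bar>) powr s) summable_on ({0..} \<union> {..<0})"
    by (rule summable_on_Un_disjoint) auto
  moreover have "{0..} \<union> {..<0} = (UNIV :: int set)"
    by auto
  ultimately show ?thesis
    by simp
qed

lemma summable_on_int_int_powr:
  assumes "s < -1"
  shows "(\<lambda>(m, k). (1 + \<bar>real_of_int m\<bar>) powr s * (1 + \<bar>real_of_int k\<bar>) powr s) summable_on UNIV"
proof -
  let ?q = "\<lambda>n::int. (1 + \<bar>real_of_int n\<bar>) powr s"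
  have "(\<lambda>(m, k). ?q m * ?q k) summable_on UNIV \<times> UNIV"
  proof (rule summable_on_SigmaI)
    show "((\<lambda>k. case (m, k) of (m, k) \<Rightarrow> ?q m * ?q k) has_sum (?q m * infsum ?q UNIV)) UNIV" for m
      using summable_on_int_powr[OF assms] by (auto intro!: has_sum_cmult_right)
    show "(\<lambda>m. ?q m * infsum ?q UNIV) summable_on UNIV"
      by (intro summable_on_cmult_left summable_on_int_powr assms)
  qed auto
  thus ?thesis by simp
qed

text \<open>
  Row \<open>m\<close> is numbered starting from its point closest to the imaginary axis, so that
  \<open>(m, k)\<close> has real part within \<open>1/2\<close> of \<open>k\<close>. This is what makes a bound in terms of
  \<open>m\<close>, \<open>k\<close> and \<open>Im \<tau>\<close> alone possible. The row \<open>m = 0\<close> keeps its numbering.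
\<close>
definition lattice_point :: "complex \<Rightarrow> int \<times> int \<Rightarrow> complex" where
  "lattice_point \<tau> = (\<lambda>(m, k). of_int m * \<tau> + of_int (k - round (of_int m * Re \<tau>)))"

lemma bij_betw_lattice_point:
  assumes "Im \<tau> > 0"
  shows "bij_betw (lattice_point \<tau>) (UNIV - {(0, 0)}) (lattice_gen \<tau> 1 - {0})"
proof -
  have inj: "inj (lattice_point \<tau>)"
  proof (rule injI, clarify)
    fix m k m' k'
    assume eq: "lattice_point \<tau> (m, k) = lattice_point \<tau> (m', k')"
    have "m = m'"
      using arg_cong[OF eq, of Im] assms by (simp add: lattice_point_def)
    thus "m = m' \<and> k = k'"
      using eq by (simp add: lattice_point_def)
  qed
  have "range (lattice_point \<tau>) = lattice_gen \<tau> 1"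
  proof (intro equalityI subsetI)
    fix \<omega> assume "\<omega> \<in> lattice_gen \<tau> 1"
    then obtain m n where "\<omega> = of_int m * \<tau> + of_int n * 1"
      by (auto simp: lattice_gen_def)
    hence "\<omega> = lattice_point \<tau> (m, n + round (of_int m * Re \<tau>))"
      by (simp add: lattice_point_def)
    thus "\<omega> \<in> range (lattice_point \<tau>)"
      by blast
  next
    fix \<omega> assume "\<omega> \<in> range (lattice_point \<tau>)"
    then obtain m k where "\<omega> = of_int m * \<tau> + of_int (k - round (of_int m * Re \<tau>)) * 1"
      by (auto simp: lattice_point_def)
    thus "\<omega> \<in> lattice_gen \<tau> 1"
      unfolding lattice_gen_def by blast
  qed
  moreover have "lattice_point \<tau> (0, 0) = 0"
    by (simp add: lattice_point_def)
  ultimately have "lattice_point \<tau> ` (UNIV - {(0, 0)}) = lattice_gen \<tau> 1 - {0}"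
    by (simp add: image_set_diff[OF inj])
  thus ?thesis
    using inj_on_subset[OF inj subset_UNIV] by (simp add: bij_betw_def)
qed

text \<open>
  With \<open>A = 1 + \<bar>k\<bar>\<close> and \<open>M = \<bar>m\<bar> Im \<tau>\<close>, the lattice point satisfies
  \<open>\<bar>\<omega>\<bar> \<ge> A / 3\<close> and \<open>\<bar>\<omega>\<bar> \<ge> M\<close>, while \<open>\<bar>z - \<omega>\<bar> \<ge> M / 2\<close>. To get a
  product of two summable factors, the three powers in the denominator are shared evenly:
  \<open>\<bar>\<omega>\<bar>\<^sup>2 \<bar>z - \<omega>\<bar> \<ge> (A/3)\<^sup>3\<^sup>/\<^sup>2 M\<^sup>1\<^sup>/\<^sup>2 (M/2)\<close>, so that both
  \<open>A\<close> and \<open>M\<close> occur to the power \<open>3/2 > 1\<close>.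
\<close>
lemma norm_zeta_summand_le:
  fixes m k :: int
  assumes y: "Im \<tau> \<ge> 1" "Im \<tau> \<ge> 2 * \<bar>Im z\<bar>" and "m \<noteq> 0"
  defines "\<omega> \<equiv> lattice_point \<tau> (m, k)"
  shows "norm (1 / (z - \<omega>) + 1 / \<omega> + z / \<omega>^2) \<le>
           2 * 6 powr (3/2) * norm z ^ 2 * Im \<tau> powr (-3/2) *
             ((1 + \<bar>real_of_int m\<bar>) powr (-3/2) * (1 + \<bar>real_of_int k\<bar>) powr (-3/2))"
proof -
  define A B M where "A = 1 + \<bar>real_of_int k\<bar>" and "B = 1 + \<bar>real_of_int m\<bar>"
    and "M = \<bar>real_of_int m\<bar> * Im \<tau>"
  have m: "\<bar>real_of_int m\<bar> \<ge> 1"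
    using \<open>m \<noteq> 0\<close> by linarith
  have M1: "M \<ge> 1"
    unfolding M_def using m y mult_mono[of 1 "\<bar>real_of_int m\<bar>" 1 "Im \<tau>"] by simp
  have MB: "M \<ge> Im \<tau> * B / 2"
    unfolding M_def B_def using mult_right_mono[OF m, of "Im \<tau>"] y by (simp add: field_simps)
  have Im: "\<bar>Im \<omega>\<bar> = M"
    using y by (simp add: \<omega>_def lattice_point_def M_def abs_mult)
  have M: "M \<le> norm \<omega>"
    using abs_Im_le_cmod[of \<omega>] Im by simp
  have zM: "M / 2 \<le> norm (z - \<omega>)"
  proof -
    have "M \<ge> 2 * \<bar>Im z\<bar>"
      unfolding M_def using y mult_right_mono[OF m, of "Im \<tau>"] by linarith
    hence "M / 2 \<le> \<bar>Im (z - \<omega>)\<bar>"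
      unfolding minus_complex.sel using Im by linarith
    thus ?thesis
      using abs_Im_le_cmod[of "z - \<omega>"] by linarith
  qed
  have A: "A / 3 \<le> norm \<omega>"
  proof (cases "k = 0")
    case True
    thus ?thesis using M M1 by (simp add: A_def)
  next
    case False
    have "Re \<omega> = of_int k - (of_int (round (of_int m * Re \<tau>)) - of_int m * Re \<tau>)"
      by (simp add: \<omega>_def lattice_point_def)
    hence "\<bar>real_of_int k\<bar> - 1 / 2 \<le> \<bar>Re \<omega>\<bar>"
      using of_int_round_abs_le[of "of_int m * Re \<tau>"] by linarith
    moreover have "\<bar>Re \<omega>\<bar> \<le> norm \<omega>"
      by (rule abs_Re_le_cmod)
    moreover have "\<bar>real_of_int k\<bar> \<ge> 1"
      using False by linarith
    (* For k = 1 and k = -1 the real part alone is too small; there M \<ge> 1 takes over. *)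
    ultimately show ?thesis
      using M M1 by (simp add: A_def)
  qed
  have pos: "A > 0" "B > 0" "M > 0" "Im \<tau> > 0" "norm \<omega> > 0" "norm (z - \<omega>) > 0"
    using M M1 zM y by (auto simp: A_def B_def)
  have "(A * (Im \<tau> * B) / 6) powr (3/2) = (A / 3) powr (3/2) * (Im \<tau> * B / 2) powr (3/2)"
    using pos by (simp flip: powr_mult)
  also have "\<dots> \<le> (A / 3) powr (3/2) * M powr (3/2)"
    using pos MB by (intro mult_left_mono powr_mono2) auto
  also have "M powr (3/2) = M powr (1/2) * M"
    using pos powr_add[of M "1/2" 1] by simp
  also have "(A / 3) powr (3/2) * (M powr (1/2) * M) \<le>
               norm \<omega> powr (3/2) * (norm \<omega> powr (1/2) * (2 * norm (z - \<omega>)))"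
    using pos A M zM by (intro mult_mono powr_mono2) auto
  also have "\<dots> = 2 * (norm \<omega> ^ 2 * norm (z - \<omega>))"
    using pos powr_add[of "norm \<omega>" "3/2" "1/2"] by simp
  finally have le: "(A * (Im \<tau> * B) / 6) powr (3/2) / 2 \<le> norm \<omega> ^ 2 * norm (z - \<omega>)"
    by simp
  have "norm (1 / (z - \<omega>) + 1 / \<omega> + z / \<omega>^2) = norm z ^ 2 / (norm \<omega> ^ 2 * norm (z - \<omega>))"
    by (subst zeta_summand_eq) (use pos in \<open>auto simp: norm_divide norm_mult norm_power\<close>)
  also have "\<dots> \<le> norm z ^ 2 / ((A * (Im \<tau> * B) / 6) powr (3/2) / 2)"
    using pos by (intro divide_left_mono le mult_pos_pos) auto
  also have "\<dots> = 2 * 6 powr (3/2) * norm z ^ 2 * Im \<tau> powr (-3/2) * (B powr (-3/2) * A powr (-3/2))"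
    using pos by (simp add: powr_mult powr_divide powr_minus field_simps)
  finally show ?thesis
    unfolding A_def B_def .
qed

section \<open>The limits\<close>

text \<open>
  The bound in the proof is quantitative: the difference from the limit is \<open>O((Im \<tau>)\<^sup>-\<^sup>3\<^sup>/\<^sup>2)\<close>.
\<close>
lemma zeta_tau_tendsto:
  assumes "z \<notin> \<int>"
  shows "((\<lambda>\<tau>. zeta_tau \<tau> z) \<longlongrightarrow>
           of_real pi * cot (of_real pi * z) + (of_real pi)\<^sup>2 / 3 * z) at_i_infinity"
proof -
  let ?L = "of_real pi * cot (of_real pi * z) + (of_real pi)\<^sup>2 / 3 * z"
  let ?q = "\<lambda>(m :: int, k :: int). (1 + \<bar>real_of_int m\<bar>) powr (-3/2) * (1 + \<bar>real_of_int k\<bar>) powr (-3/2)"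
  define f where "f = (\<lambda>\<omega>. 1 / (z - \<omega>) + 1 / \<omega> + z / \<omega>^2)"
  define I :: "(int \<times> int) set" where "I = (UNIV - {0}) \<times> UNIV"
  define C where "C = 2 * 6 powr (3/2) * norm z ^ 2 * infsum ?q I"
  have q: "?q summable_on I"
    by (rule summable_on_subset[OF summable_on_int_int_powr]) auto
  have bound: "norm (zeta_tau \<tau> z - ?L) \<le> C * Im \<tau> powr (-3/2)"
    if y: "Im \<tau> \<ge> 1" "Im \<tau> \<ge> 2 * \<bar>Im z\<bar>" for \<tau>
  proof -
    let ?g = "\<lambda>p. f (lattice_point \<tau> p)"
    let ?c = "2 * 6 powr (3/2) * norm z ^ 2 * Im \<tau> powr (-3/2)"
    have cq: "((\<lambda>p. ?c * ?q p) has_sum (?c * infsum ?q I)) I"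
      using q by (intro has_sum_cmult_right) auto
    have le: "norm (?g p) \<le> ?c * ?q p" if "p \<in> I" for p
      using that norm_zeta_summand_le[OF y] by (auto simp: I_def f_def)
    have "(\<lambda>p. norm (?g p)) summable_on I"
      by (rule Infinite_Sum.abs_summable_on_comparison_test'[OF has_sum_imp_summable[OF cq] le])
    hence "?g summable_on I"
      by (rule abs_summable_summable)
    then obtain S where S: "(?g has_sum S) I"
      by (auto simp: summable_on_def)
    have S_le: "norm S \<le> ?c * infsum ?q I"
      using S cq le by (rule norm_infsum_le)
    have row: "(?g has_sum (?L - 1 / z)) ({0} \<times> (UNIV - {0}))"
    proof -
      have "((\<lambda>k. f (of_int k)) has_sum (?L - 1 / z)) (UNIV - {0 :: int})"
        using has_sum_zeta_summand_int[OF assms] by (simp add: f_def algebra_simps)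
      also have "?this \<longleftrightarrow> ?thesis"
        by (intro has_sum_reindex_bij_witness[of _ snd "\<lambda>k. (0, k)"]) (auto simp: lattice_point_def)
      finally show ?thesis .
    qed
    have "(?g has_sum (?L - 1 / z + S)) ({0} \<times> (UNIV - {0}) \<union> I)"
      by (intro has_sum_Un_disjoint row S) (auto simp: I_def)
    also have "{0} \<times> (UNIV - {0}) \<union> I = UNIV - {(0, 0)}"
      by (auto simp: I_def)
    also have "(?g has_sum (?L - 1 / z + S)) (UNIV - {(0, 0)}) \<longleftrightarrow>
               (f has_sum (?L - 1 / z + S)) (lattice_gen \<tau> 1 - {0})"
      using y by (intro has_sum_reindex_bij_betw bij_betw_lattice_point) auto
    finally have "infsum f (lattice_gen \<tau> 1 - {0}) = ?L - 1 / z + S"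
      by (rule infsumI)
    hence "zeta_tau \<tau> z - ?L = S"
      by (simp add: zeta_tau_def weierstrass_zeta_def f_def)
    thus ?thesis
      using S_le by (simp add: C_def mult_ac)
  qed
  have Im_at_top: "filterlim Im at_top at_i_infinity"
    unfolding at_i_infinity_def by (rule filterlim_mono[OF filterlim_filtercomap order.refl inf.cobounded1])
  have "((\<lambda>y. C * y powr (-3/2)) \<longlongrightarrow> C * 0) at_top"
    by (intro tendsto_mult tendsto_const tendsto_neg_powr filterlim_ident) auto
  from filterlim_compose[OF this Im_at_top]
  have "((\<lambda>\<tau>. C * Im \<tau> powr (-3/2)) \<longlongrightarrow> 0) at_i_infinity"
    by simp
  moreover have "eventually (\<lambda>\<tau>. norm (zeta_tau \<tau> z - ?L) \<le> C * Im \<tau> powr (-3/2)) at_i_infinity"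
    unfolding eventually_at_i_infinity
    by (intro exI[of _ "max 1 (2 * \<bar>Im z\<bar>)"] ballI impI bound) auto
  ultimately have "((\<lambda>\<tau>. zeta_tau \<tau> z - ?L) \<longlongrightarrow> 0) at_i_infinity"
    by (rule Lim_null_comparison[rotated])
  thus ?thesis
    by (rule LIM_zero_cancel)
qed

lemma pi_cot_eq_e_exp:
  assumes "z \<notin> \<int>"
  shows "of_real pi * cot (of_real pi * z) = 2 * of_real pi * \<i> * (1 / 2 + 1 / (e_exp z - 1))"
proof -
  define w where "w = exp (\<i> * (of_real pi * z))"
  have w: "w \<noteq> 0" "exp (- (\<i> * (of_real pi * z))) = inverse w"
    by (simp_all add: w_def exp_minus)
  have e: "e_exp z = w ^ 2"
    by (simp add: e_exp_def w_def mult_ac flip: exp_double)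
  have "w - inverse w = (w ^ 2 - 1) / w" "w + inverse w = (w ^ 2 + 1) / w"
    using w(1) by (simp_all add: field_simps power2_eq_square)
  hence sin: "sin (of_real pi * z) = (w ^ 2 - 1) / w / (2 * \<i>)"
    and cos: "cos (of_real pi * z) = (w ^ 2 + 1) / w / 2"
    by (simp_all only: sin_exp_eq cos_exp_eq w(2) w_def [symmetric])
  have "sin (of_real pi * z) \<noteq> 0"
  proof
    assume "sin (of_real pi * z) = 0"
    then obtain n :: int where "of_real pi * z = of_real (real_of_int n * pi)"
      by (auto simp: sin_eq_0)
    hence "z = of_int n"
      by simp
    thus False using assms by auto
  qed
  hence ne: "w ^ 2 - 1 \<noteq> 0"
    unfolding sin by auto
  have "a / w / 2 / (b / w / (2 * \<i>)) = \<i> * (a / b)" if "b \<noteq> 0" for a b :: complex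
    using that w(1) by (simp add: divide_simps)
  from this[OF ne, of "w ^ 2 + 1"]
  have "cot (of_real pi * z) = \<i> * ((w ^ 2 + 1) / (w ^ 2 - 1))"
    by (simp only: cot_def sin cos)
  also have "(w ^ 2 + 1) / (w ^ 2 - 1) = ((w ^ 2 - 1) + 2) / (w ^ 2 - 1)"
    by simp
  also have "\<dots> = 1 + 2 / (w ^ 2 - 1)"
    by (simp only: add_divide_distrib divide_self[OF ne])
  finally show ?thesis
    unfolding e by (simp add: distrib_left)
qed

theorem mainTheorem4:
  fixes t :: rat and r :: int
  assumes "t \<notin> \<int>" and "r \<noteq> 0" and "of_int r * t \<notin> \<int>"
  shows "(h_zero r t \<longlongrightarrow>
           2 * of_real pi * \<i> *
             ((of_int r - 1) / 2 + of_int r / (e_exp (of_rat t) - 1)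
               - 1 / (e_exp (of_int r * of_rat t) - 1))) at_i_infinity"
proof -
  have of_rat: "(of_rat q :: complex) \<notin> \<int>" if "q \<notin> \<int>" for q
    using that by (metis Ints_cases Ints_of_int of_rat_eq_iff of_rat_of_int_eq)
  have t: "(of_rat t :: complex) \<notin> \<int>"
    by (rule of_rat) fact
  have rt: "(of_int r * of_rat t :: complex) \<notin> \<int>"
    using of_rat[OF assms(3)] by (simp add: of_rat_mult)
  have "(h_zero r t \<longlongrightarrow>
          of_int r * (of_real pi * cot (of_real pi * of_rat t) + (of_real pi)\<^sup>2 / 3 * of_rat t)
          - (of_real pi * cot (of_real pi * (of_int r * of_rat t))
               + (of_real pi)\<^sup>2 / 3 * (of_int r * of_rat t))) at_i_infinity"
    unfolding h_zero_def by (intro tendsto_intros zeta_tau_tendsto t rt)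
  also have "of_int r * (of_real pi * cot (of_real pi * of_rat t) + (of_real pi)\<^sup>2 / 3 * of_rat t)
          - (of_real pi * cot (of_real pi * (of_int r * of_rat t))
               + (of_real pi)\<^sup>2 / 3 * (of_int r * of_rat t)) =
        2 * of_real pi * \<i> *
             ((of_int r - 1) / 2 + of_int r / (e_exp (of_rat t) - 1)
               - 1 / (e_exp (of_int r * of_rat t) - 1))"
    unfolding pi_cot_eq_e_exp[OF t] pi_cot_eq_e_exp[OF rt]
    by (simp add: ring_distribs diff_divide_distrib)
  finally show ?thesis .
qed

end
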